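(* Let $n\ge1$ and $S=\{(a_i,b_i)\}_{i=1}^{n+1}\subset\mathbb R_{>0}\times\mathbb R_{\ge0}$ with $0<a_1<\cdots<a_{n+1}$. Assume $f$ is the minimal polynomial of $S$, that $S_n:=\{(a_i,b_i)\}_{i=1}^n$ has a minimal polynomial $f_0\in\mathbb R_{\ge0}[X]$, that $\mathfrak d(f_0)=n$, and that $f_0\neq f$. Let $s=\mathrm{Sign}(f_0)$ and write $\operatorname{supp}(\lfloor s\rfloor)=\{d_1>\cdots>d_n\}$ (it has exactly $n$ elements). Let $M$ be the $(n+1)\times n$ matrix whose $l$-th row is $(a_l^{d_n},a_l^{d_{n-1}},\dots,a_l^{d_1})$, and $\mathbf b=(b_1,\dots,b_{n+1})^t$. For $j\in[n]$ let $\Delta_j$ be the matrix obtained from $M$ by replacing its $(n-j+1)$-th column (the column with entries $a_l^{d_j}$) by $\mathbf b$; for $i\in[n+1]$ let $\Delta_j^{(i)}$ be the $n\times n$ matrix obtained from $\Delta_j$ by deleting its $i$-th row, and $D_j^{(i)}=\det\Delta_j^{(i)}$. Then: (1) $D_j^{(i)}>0$ for every odd $j\in[n]$ and every $i\in[n+1]$. (2) If $k$ is the least natural number such that $k>d_1$ and $k\ge \dfrac{\log\bigl(nD_j^{(i)}/D_j^{(n+1)}\bigr)}{\log(a_{n+1}/a_i)}$ for every odd $j\in[n]$ and every $i\in[n]$, then $\deg(f)\le k$.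
   Context: $\mathbb R_{\ge0}[X]$: real polynomials with nonnegative coefficients; interpolating means $f(a_i)=b_i$. $\omega=\{0,1,\dots\}$, $[m]=\{1,\dots,m\}$. A finite sign sequence is $s\in\{-,0,+\}^\omega$ with finitely many nonzero entries; $\mathscr S$ their set, $\operatorname{supp}(s)=\{i:s_i\ne0\}$, $\mathscr S_+=\mathscr S\cap\{0,+\}^\omega$; $\mathrm{Sign}(f)$ is the sequence of signs of coefficients of $f$. $\mathrm{SC}(t)$ = number of pairs $i<j$ with $\{t_i,t_j\}=\{-,+\}$ and $t_k=0$ for $i<k<j$. $\mathfrak d(s)=\max\{\mathrm{SC}(t):t\in\mathscr S,\ t_i\in\{-,0,s_i\}\ \forall i\}$ for $s\in\mathscr S_+$, $\mathfrak d(f)=\mathfrak d(\mathrm{Sign} f)$. For a set of $m$ points with distinct positive first coordinates, $f\in\mathbb R_{\ge0}[X]$ interpolating it is its minimal polynomial if $\mathfrak d(f)\le m$. Interval decomposition of $s\in\mathscr S_+$: $\operatorname{supp}(s)=X_0\amalg\cdots\amalg X_k$ into intervals of $\omega$ with $0\in X_0$ if $0\in\operatorname{supp}(s)$ else $X_0=\emptyset$, $X_i\ne\emptyset$ for $i\ge1$, $\min X_i-\max X_{i-1}\ge2$ ($\max\emptyset=-\infty$). $\lfloor s\rfloor\in\mathscr S_+$ has support $X_0\amalg\lfloor X_1\rfloor\amalg\cdots\amalg\lfloor X_k\rfloor$, where $\lfloor X_i\rfloor=\{\min X_i-1\}\amalg X_i$ if $\#X_i$ is odd and $X_i$ otherwise.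 *)

theory Defs
  imports Complex_Main "HOL-Computational_Algebra.Polynomial" "Jordan_Normal_Form.Determinant"
begin

definition sign_seqs :: "(nat \<Rightarrow> int) set" where
  "sign_seqs = {s. finite {i. s i \<noteq> 0} \<and> (\<forall>i. s i \<in> {-1, 0, 1})}"

definition sign_seqs_pos :: "(nat \<Rightarrow> int) set" where
  "sign_seqs_pos = {s. s \<in> sign_seqs \<and> (\<forall>i. s i \<in> {0, 1})}"

definition ssupp :: "(nat \<Rightarrow> int) \<Rightarrow> nat set" where
  "ssupp s = {i. s i \<noteq> 0}"

definition nonneg_poly :: "real poly \<Rightarrow> bool" where
  "nonneg_poly f \<longleftrightarrow> (\<forall>i. coeff f i \<ge> 0)"

definition Sign :: "real poly \<Rightarrow> nat \<Rightarrow> int" where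
  "Sign f i = (if coeff f i > 0 then 1 else if coeff f i < 0 then -1 else 0)"

definition SC :: "(nat \<Rightarrow> int) \<Rightarrow> nat" where
  "SC t = card {(i, j). i < j \<and> {t i, t j} = {-1, 1} \<and> (\<forall>k. i < k \<and> k < j \<longrightarrow> t k = 0)}"

definition dfrak :: "(nat \<Rightarrow> int) \<Rightarrow> nat" where
  "dfrak s = Max {SC t | t. t \<in> sign_seqs \<and> (\<forall>i. t i \<in> {-1, 0, s i})}"

definition dfrak_poly :: "real poly \<Rightarrow> nat" where
  "dfrak_poly f = dfrak (Sign f)"

definition is_minpoly :: "(real \<times> real) set \<Rightarrow> real poly \<Rightarrow> bool" where
  "is_minpoly P f \<longleftrightarrow> finite P \<and> inj_on fst P \<and> (\<forall>(x, y)\<in>P. x > 0)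
     \<and> nonneg_poly f \<and> (\<forall>(x, y)\<in>P. poly f x = y) \<and> dfrak_poly f \<le> card P"

definition is_run :: "nat set \<Rightarrow> nat set \<Rightarrow> bool" where
  "is_run A X \<longleftrightarrow> (\<exists>p q. p \<le> q \<and> X = {p..q} \<and> X \<subseteq> A
      \<and> (p > 0 \<longrightarrow> p - 1 \<notin> A) \<and> Suc q \<notin> A)"

(* support of \<lfloor>s\<rfloor>: X_0 unchanged, X_i (i \<ge> 1, i.e. runs not containing 0) of odd size
   get min X_i - 1 added *)
definition floor_supp :: "nat set \<Rightarrow> nat set" where
  "floor_supp A = A \<union> {Min X - 1 | X. is_run A X \<and> 0 \<notin> X \<and> odd (card X)}"

definition floor_sign :: "(nat \<Rightarrow> int) \<Rightarrow> nat \<Rightarrow> int" where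
  "floor_sign s i = (if i \<in> floor_supp (ssupp s) then 1 else 0)"

(* d_1 > d_2 > ... : d j = j-th largest element (1-based) *)
definition dseq :: "nat set \<Rightarrow> nat \<Rightarrow> nat" where
  "dseq A j = rev (sorted_list_of_set A) ! (j - 1)"

(* D_j^{(i)}: det of Delta_j with row i deleted; M has l-th row (a_l^{d_n},...,a_l^{d_1}),
   column c (1-based) has entries a_l^{d_{n-c+1}}; Delta_j replaces column n-j+1 by b. *)
definition Dji :: "nat \<Rightarrow> (nat \<Rightarrow> real) \<Rightarrow> (nat \<Rightarrow> real) \<Rightarrow> (nat \<Rightarrow> nat) \<Rightarrow> nat \<Rightarrow> nat \<Rightarrow> real" where
  "Dji n a b d j i = det (mat n n (\<lambda>(r, c).
      let l = (if Suc r < i then Suc r else Suc (Suc r)); e = n - c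
      in if e = j then b l else a l ^ d e))"

end

theory Submission
  imports Defs
begin

text \<open>
  If two distinct polynomials \<open>f\<close> and \<open>q\<close> with nonnegative coefficients agree at \<open>m\<close> positive
  points, then by Descartes' rule \<open>f - q\<close> has at least \<open>m\<close> sign changes, and its positive
  coefficients sit in the support of \<open>f\<close>; hence \<open>m \<le> dfrak_poly f\<close>. If moreover \<open>f - q\<close> has
  positive leading coefficient, appending a minus sign improves this to \<open>m < dfrak_poly f\<close>.

  Applied to \<open>f0\<close> and \<open>f\<close> this gives \<open>f0 (a (n+1)) < b (n+1)\<close>. Hence deleting node \<open>i\<close> amounts to
  interpolating the values of \<open>f0\<close> plus a positive error \<open>\<delta>\<close> at the last node, and Cramer's rule
  with the positivity of generalized Vandermonde determinants yields \<open>D j i > 0\<close> for odd \<open>j\<close>.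

  If \<open>k\<close> satisfies the logarithmic bounds, the polynomial \<open>p\<close> with exponents \<open>d n, ..., d 1, k\<close> that
  interpolates all \<open>n + 1\<close> points has nonnegative coefficients: for even \<open>j\<close> by the same sign
  computation, and for odd \<open>j\<close> because in the Laplace expansion along the column of exponent \<open>k\<close>
  the term of the last node dominates the sum of the others. If \<open>f\<close> had degree above \<open>k\<close>, then \<open>f - p\<close>
  would have positive leading coefficient and \<open>n + 1\<close> positive roots, so \<open>dfrak_poly f > n + 1\<close>.
\<close>

section \<open>Descartes' rule of signs\<close>

definition changes :: "(nat \<Rightarrow> int) \<Rightarrow> (nat \<times> nat) set" where
  "changes t = {(i, j). i < j \<and> {t i, t j} = {-1, 1} \<and> (\<forall>k. i < k \<and> k < j \<longrightarrow> t k = 0)}"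

lemma SC_eq_card_changes: "SC t = card (changes t)"
  by (simp add: SC_def changes_def)

lemma changes_iff:
  "(i, j) \<in> changes t \<longleftrightarrow>
     i < j \<and> (t i = -1 \<and> t j = 1 \<or> t i = 1 \<and> t j = -1) \<and> (\<forall>k. i < k \<and> k < j \<longrightarrow> t k = 0)"
  by (auto simp: changes_def doubleton_eq_iff)

lemma finite_changes:
  assumes "finite {i. t i \<noteq> 0}"
  shows "finite (changes t)"
proof (rule finite_subset)
  show "changes t \<subseteq> {i. t i \<noteq> 0} \<times> {i. t i \<noteq> 0}"
    by (auto simp: changes_iff)
qed (use assms in simp)

text \<open>A nonzero entry strictly between the ends is opposite in sign to one of them, so it
  yields a shorter interval with opposite ends; hence induction on \<open>j - i\<close>.\<close>

lemma changes_nonempty: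
  assumes "t i * t j = -1" "i < j" "\<And>k. t k \<in> {-1, 0, 1}"
  shows "changes t \<noteq> {}"
  using assms(1,2)
proof (induction "j - i" arbitrary: i j rule: less_induct)
  case less
  have ij: "t i = -1 \<and> t j = 1 \<or> t i = 1 \<and> t j = -1"
    using assms(3)[of i] assms(3)[of j] less.prems by auto
  show ?case
  proof (cases "\<forall>k. i < k \<and> k < j \<longrightarrow> t k = 0")
    case True
    then have "(i, j) \<in> changes t" using ij less.prems by (auto simp: changes_iff)
    then show ?thesis by blast
  next
    case False
    then obtain k where k: "i < k" "k < j" "t k \<noteq> 0" by blast
    then consider "t i * t k = -1" | "t k * t j = -1"
      using assms(3)[of k] ij by auto
    then show ?thesis
      using less.hyps[of k i] less.hyps[of j k] k by cases auto
  qed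
qed

text \<open>Negating both ends preserves a change, so only pairs with one end at most
  \<open>i\<close> and the other above \<open>i\<close> are affected. As \<open>t\<close> vanishes
  between \<open>i\<close> and \<open>j\<close>, the only such pair with nonzero ends and zero
  interior is \<open>(i, j)\<close>.\<close>

lemma changes_flip_below:
  assumes ij: "(i, j) \<in> changes t"
  shows "changes (\<lambda>m. if m \<le> i then - t m else t m) = changes t - {(i, j)}"
    (is "changes ?u = _")
proof -
  have z: "?u m = 0 \<longleftrightarrow> t m = 0" for m by simp
  have ij': "i < j" "t i \<noteq> 0" "t j \<noteq> 0" "\<And>k. i < k \<Longrightarrow> k < j \<Longrightarrow> t k = 0" "t i = - t j"
    using ij by (auto simp: changes_iff)
  have "(i', j') \<in> changes ?u \<longleftrightarrow> (i', j') \<in> changes t - {(i, j)}" for i' j'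
  proof (cases "i' \<le> i \<and> i < j'")
    case True
    have eq: "i' = i \<and> j' = j"
      if nz: "t i' \<noteq> 0" "t j' \<noteq> 0" and gap: "\<forall>k. i' < k \<and> k < j' \<longrightarrow> t k = 0"
      using that ij' True by (metis le_neq_implies_less linorder_neqE_nat order_le_less_trans)
    have "(i', j') \<notin> changes ?u"
    proof
      assume *: "(i', j') \<in> changes ?u"
      then have "t i' \<noteq> 0" "t j' \<noteq> 0" "\<forall>k. i' < k \<and> k < j' \<longrightarrow> t k = 0"
        unfolding changes_iff using z by (metis (no_types, lifting) neg_equal_0_iff_equal zero_neq_neg_one zero_neq_one)+
      then have "i' = i" "j' = j" using eq by blast+
      then show False using * ij' by (auto simp: changes_iff)
    qed
    moreover have "(i', j') \<notin> changes t - {(i, j)}"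
      using eq by (auto simp: changes_iff)
    ultimately show ?thesis by blast
  next
    case False
    then show ?thesis using ij'(1) by (auto simp: changes_iff)
  qed
  then show ?thesis by auto
qed

lemma Sign_in_sign_seqs: "Sign p \<in> sign_seqs"
proof -
  have "{i. Sign p i \<noteq> 0} \<subseteq> {..degree p}"
    by (auto simp: Sign_def le_degree split: if_splits)
  then have "finite {i. Sign p i \<noteq> 0}" by (rule finite_subset) simp
  then show ?thesis by (simp add: sign_seqs_def) (simp add: Sign_def)
qed

lemma finite_changes_Sign: "finite (changes (Sign p))"
  using Sign_in_sign_seqs finite_changes by (auto simp: sign_seqs_def)

text \<open>The bound by \<open>Max Z\<close> drives the induction: when a new largest root
  \<open>b\<close> is added, Rolle gives a zero of the derivative above the old maximum, hence
  distinct from the earlier ones.\<close>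

lemma Rolle_card:
  fixes F F' :: "real \<Rightarrow> real"
  assumes "finite Z" "Z \<noteq> {}" "\<And>z. z \<in> Z \<Longrightarrow> z > 0 \<and> F z = 0"
    and der: "\<And>x. x > 0 \<Longrightarrow> (F has_real_derivative F' x) (at x)"
  shows "\<exists>Y. finite Y \<and> Suc (card Y) = card Z \<and> Y \<subseteq> {0<..<Max Z} \<and> (\<forall>y\<in>Y. F' y = 0)"
  using assms(1-3)
proof (induction rule: finite_linorder_max_induct)
  case empty
  then show ?case by simp
next
  case (insert b A)
  show ?case
  proof (cases "A = {}")
    case True
    then show ?thesis by (intro exI[of _ "{}"]) simp
  next
    case False
    define m where "m = Max A"
    have m: "m \<in> A" using False insert.hyps(1) by (simp add: m_def)
    then have mb: "0 < m" "m < b" "F m = 0" "F b = 0"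
      using insert.hyps(2) insert.prems(2) by simp_all
    obtain Y where Y: "finite Y" "Suc (card Y) = card A" "Y \<subseteq> {0<..<m}" "\<forall>y\<in>Y. F' y = 0"
      using insert.IH insert.prems(2) False unfolding m_def by auto
    have "\<exists>z. m < z \<and> z < b \<and> (\<lambda>v. F' z * v) = (\<lambda>v. 0)"
    proof (rule Rolle_deriv[where f = F and f' = "\<lambda>z v. F' z * v"])
      show "continuous_on {m..b} F"
        by (rule DERIV_continuous_on[where D = F'], rule has_field_derivative_at_within, rule der)
          (use mb in simp)
      show "(F has_derivative (\<lambda>v. F' x * v)) (at x)" if "m < x" "x < b" for x
        using der[of x] that mb by (simp add: has_field_derivative_def)
    qed (use mb in auto)
    then obtain z where z: "m < z" "z < b" "F' z = 0"
      by (metis mult.right_neutral)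
    have "Max (insert b A) = b"
      using insert by (intro Max_eqI) auto
    moreover have "z \<notin> Y" using Y z by auto
    moreover have "b \<notin> A" using insert by auto
    ultimately show ?thesis
      using Y z mb insert.hyps by (intro exI[of _ "insert z Y"]) auto
  qed
qed

text \<open>If \<open>(i, j)\<close> is a sign change of \<open>g\<close> and
  \<open>c = i + 1/2\<close>, then differentiating \<open>x powr (-c) * g x\<close> multiplies the \<open>m\<close>-th coefficient by
  \<open>m - c\<close>: this removes precisely that sign change, and at most one root by Rolle.\<close>

theorem card_positive_roots_le_SC:
  fixes g :: "real poly"
  assumes "g \<noteq> 0" "finite Z" "\<And>z. z \<in> Z \<Longrightarrow> z > 0 \<and> poly g z = 0"
  shows "card Z \<le> SC (Sign g)"
  using assms
proof (induction "SC (Sign g)" arbitrary: g Z)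
  case 0
  have vals: "Sign g k \<in> {-1, 0, 1}" for k by (simp add: Sign_def)
  have empty: "changes (Sign g) = {}"
    using 0(1) finite_changes_Sign by (simp add: SC_eq_card_changes)
  have same: "Sign g i * Sign g j \<noteq> -1" for i j
  proof
    assume prod: "Sign g i * Sign g j = -1"
    then have "i \<noteq> j" by (metis zero_le_square not_le less_minus_one_simps(1))
    then show False
      using changes_nonempty[OF prod _ vals] changes_nonempty[of "Sign g" j i, OF _ _ vals] prod empty
      by (metis linorder_neqE_nat mult.commute)
  qed
  have "Z = {}"
  proof (rule ccontr)
    assume "Z \<noteq> {}"
    then obtain z where z: "z > 0" "poly g z = 0" using 0 by blast
    \<comment> \<open>Without sign changes all nonzero coefficients share the sign of the leading
      one; multiplying by it makes every term nonnegative.\<close>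
    let ?s = "real_of_int (Sign g (degree g))"
    have nonneg: "?s * coeff g i \<ge> 0" for i
      using same[of i "degree g"] by (simp add: Sign_def split: if_splits)
    have "?s * coeff g (degree g) > 0"
      using \<open>g \<noteq> 0\<close> leading_coeff_0_iff[of g] by (simp add: Sign_def split: if_splits)
    then have "0 < (\<Sum>i\<le>degree g. ?s * coeff g i * z ^ i)"
      using z nonneg by (intro sum_pos2[of _ "degree g"]) simp_all
    also have "\<dots> = ?s * poly g z"
      by (simp add: poly_altdef sum_distrib_left mult.assoc)
    finally show False using z by simp
  qed
  then show ?case by simp
next
  case (Suc S)
  show ?case
  proof (cases "Z = {}")
    case False
    have "changes (Sign g) \<noteq> {}"
      using Suc(2) by (auto simp: SC_eq_card_changes)
    then obtain i j where ij: "(i, j) \<in> changes (Sign g)" by auto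
    \<comment> \<open>The half-integer keeps every factor \<open>m - c\<close> nonzero. Below,
      \<open>h\<close> is x g' - c g, so that the derivative of \<open>x powr (-c) * g x\<close> is
      \<open>x powr (-c - 1) * h x\<close>.\<close>
    define c where "c = real i + 1/2"
    define h where "h = pCons 0 (pderiv g) - smult c g"
    have coeff_h: "coeff h m = (real m - c) * coeff g m" for m
      by (cases m) (auto simp: h_def coeff_pderiv algebra_simps)
    have Sign_h: "Sign h = (\<lambda>m. if m \<le> i then - Sign g m else Sign g m)"
    proof
      fix m
      show "Sign h m = (if m \<le> i then - Sign g m else Sign g m)"
      proof (cases "m \<le> i")
        case True
        then have "real m - c < 0" by (simp add: c_def)
        with True show ?thesis
          by (simp add: Sign_def coeff_h zero_less_mult_iff mult_less_0_iff)
      next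
        case False
        then have "real m - c > 0" by (simp add: c_def)
        with False show ?thesis
          by (simp add: Sign_def coeff_h zero_less_mult_iff mult_less_0_iff)
      qed
    qed
    have "SC (Sign h) = S"
      using Suc(2) ij finite_changes_Sign[of g]
      by (simp add: SC_eq_card_changes Sign_h changes_flip_below)
    moreover have "h \<noteq> 0"
    proof -
      have "coeff g i \<noteq> 0" using ij by (auto simp: changes_iff Sign_def)
      then have "coeff h i \<noteq> 0" by (simp add: coeff_h c_def)
      then show ?thesis by auto
    qed
    moreover obtain Y where Y: "finite Y" "Suc (card Y) = card Z" "Y \<subseteq> {0<..<Max Z}"
      "\<forall>y\<in>Y. y powr (-c - 1) * poly h y = 0"
    proof -
      have "((\<lambda>x. x powr (-c) * poly g x) has_real_derivative x powr (-c - 1) * poly h x) (at x)"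
        if "x > 0" for x
      proof -
        have "x powr (-c) = x powr (-c - 1) * x"
          using that by (simp add: powr_diff)
        moreover have "((\<lambda>x. x powr (-c) * poly g x) has_real_derivative
            x powr (-c) * poly (pderiv g) x + (-c * x powr (-c - 1)) * poly g x) (at x)"
          using that by (auto intro!: derivative_eq_intros)
        ultimately show ?thesis by (simp add: h_def algebra_simps)
      qed
      then have "\<exists>Y. finite Y \<and> Suc (card Y) = card Z \<and> Y \<subseteq> {0<..<Max Z}
          \<and> (\<forall>y\<in>Y. y powr (-c - 1) * poly h y = 0)"
        using Suc.prems False
        by (intro Rolle_card[where F = "\<lambda>x. x powr (-c) * poly g x"]) auto
      then show ?thesis using that by blast
    qed
    moreover have "y > 0 \<and> poly h y = 0" if "y \<in> Y" for y
    proof -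
      have "y > 0" using Y(3) that by auto
      then show ?thesis using Y(4) that by auto
    qed
    ultimately have "card Y \<le> S"
      using Suc(1)[of h Y] by simp
    then show ?thesis using Y(2) Suc(2) by simp
  qed simp
qed

section \<open>The invariant \<open>dfrak\<close> and the floor of a support\<close>

text \<open>The elements at even distance from the top of their run. The pairs \<open>{p - 1, p}\<close>
  with \<open>p\<close> in this set tile \<open>floor_supp A\<close> (where \<open>p = 0\<close> contributes only itself).\<close>

definition odd_tops :: "nat set \<Rightarrow> nat set" where
  "odd_tops A = {m. \<exists>q\<ge>m. {m..q} \<subseteq> A \<and> Suc q \<notin> A \<and> even (q - m)}"

lemma odd_tops_subset: "odd_tops A \<subseteq> A"
  by (force simp: odd_tops_def)

text \<open>Both elements would lie in one run with the same top, at distances of different parity.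
  Consequently the pairs \<open>{p - 1, p}\<close> are disjoint.\<close>

lemma odd_tops_not_adjacent:
  assumes "m \<in> odd_tops A"
  shows "Suc m \<notin> odd_tops A"
proof
  assume "Suc m \<in> odd_tops A"
  then obtain q' where q': "Suc m \<le> q'" "{Suc m..q'} \<subseteq> A" "Suc q' \<notin> A" "even (q' - Suc m)"
    by (auto simp: odd_tops_def)
  obtain q where q: "m \<le> q" "{m..q} \<subseteq> A" "Suc q \<notin> A" "even (q - m)"
    using assms by (auto simp: odd_tops_def)
  have "Suc q \<in> {Suc m..q'}" if "q < q'" using that q(1) by simp
  moreover have "Suc q' \<in> {m..q}" if "q' < q" using that q'(1) by simp
  ultimately have "q = q'" using q(2,3) q'(2,3) by (metis linorder_neqE_nat subsetD)
  then show False using q(1,4) q'(1,4) by (auto simp: even_diff_nat)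
qed

text \<open>Pairing each run from its top downwards leaves the minimum of an odd run to be paired
  with its predecessor, which is the element that the floor adds; an odd run starting at 0 has no
  predecessor to add.\<close>

lemma floor_supp_eq:
  assumes "finite A"
  shows "floor_supp A = odd_tops A \<union> {m. Suc m \<in> odd_tops A}"
proof (intro equalityI subsetI)
  fix m assume "m \<in> floor_supp A"
  then consider "m \<in> A" | X where "m = Min X - 1" "is_run A X" "0 \<notin> X" "odd (card X)"
    by (auto simp: floor_supp_def)
  then show "m \<in> odd_tops A \<union> {m. Suc m \<in> odd_tops A}"
  proof cases
    case 1
    have "\<exists>q. m \<le> q \<and> Suc q \<notin> A"
      using assms by (metis Suc_n_not_le_n finite_nat_set_iff_bounded_le nle_le le_SucI)
    then obtain q where q: "m \<le> q" "Suc q \<notin> A" "\<And>r. r < q \<Longrightarrow> \<not> (m \<le> r \<and> Suc r \<notin> A)"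
      using exists_least_iff[of "\<lambda>q. m \<le> q \<and> Suc q \<notin> A"] by blast
    have sub: "{m..q} \<subseteq> A"
    proof
      fix x assume x: "x \<in> {m..q}"
      show "x \<in> A"
      proof (cases "x = m")
        case False
        then have "x - 1 < q" "m \<le> x - 1" "Suc (x - 1) = x" using x by auto
        then show ?thesis using q(3)[of "x - 1"] by auto
      qed (use 1 in simp)
    qed
    show ?thesis
    proof (cases "even (q - m)")
      case True
      then show ?thesis using q(1,2) sub by (auto simp: odd_tops_def)
    next
      case False
      then have "Suc m \<le> q" by (metis diff_is_0_eq' even_zero not_less_eq_eq)
      then have "Suc m \<in> odd_tops A"
        using q(2) sub False by (auto simp: odd_tops_def intro!: exI[of _ q])
      then show ?thesis by simp
    qed
  next
    case 2
    then obtain p q where pq: "p \<le> q" "X = {p..q}" "{p..q} \<subseteq> A" "Suc q \<notin> A"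
      by (auto simp: is_run_def)
    have "Min X = p" using pq(1,2) by (auto intro: Min_eqI)
    moreover have "p > 0" using 2(3) pq(1,2) by (cases p) auto
    moreover have "even (q - p)" using 2(4) pq(1,2) by (simp add: Suc_diff_le)
    ultimately show ?thesis using 2(1) pq by (auto simp: odd_tops_def)
  qed
next
  fix m assume "m \<in> odd_tops A \<union> {m. Suc m \<in> odd_tops A}"
  then consider "m \<in> A" | "m \<notin> A" "Suc m \<in> odd_tops A"
    using odd_tops_subset by blast
  then show "m \<in> floor_supp A"
  proof cases
    case 2
    then obtain q where q: "Suc m \<le> q" "{Suc m..q} \<subseteq> A" "Suc q \<notin> A" "even (q - Suc m)"
      by (auto simp: odd_tops_def)
    then have "is_run A {Suc m..q}" using 2(1) by (auto simp: is_run_def)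
    moreover have "Min {Suc m..q} = Suc m" using q(1) by (auto intro: Min_eqI)
    moreover have "odd (card {Suc m..q})" using q(1,4) by (simp add: Suc_diff_le)
    ultimately show ?thesis
      by (auto simp: floor_supp_def intro!: exI[of _ "{Suc m..q}"])
  qed (simp add: floor_supp_def)
qed

lemma finite_floor_supp:
  assumes "finite A"
  shows "finite (floor_supp A)"
proof -
  have "finite (odd_tops A)" using assms odd_tops_subset by (rule finite_subset[rotated])
  moreover from this have "finite (Suc -` odd_tops A)" by (rule finite_vimageI) simp
  ultimately show ?thesis by (simp add: floor_supp_eq assms vimage_def)
qed

text \<open>Each sign change has a positive end, which lies in one of the pairs \<open>{p - 1, p}\<close> with
  \<open>p\<close> in \<open>odd_tops A\<close>. A change from plus to minus is charged to \<open>p\<close>, and one from minus to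
  plus to \<open>p - 1\<close>.\<close>

lemma SC_le_card_floor_supp:
  assumes "finite A" "\<And>i. t i = 1 \<Longrightarrow> i \<in> A"
  shows "SC t \<le> card (floor_supp A)"
  unfolding SC_eq_card_changes
proof (rule card_inj_on_le)
  define P where "P = odd_tops A"
  define \<phi> where "\<phi> = (\<lambda>(i, j). if t i = 1 then (if i \<in> P then i else Suc i)
                               else (if j \<in> P then j - 1 else j))"
  have A: "i \<in> P \<or> Suc i \<in> P" if "t i = 1" for i
    using assms(2)[OF that] assms(1) floor_supp_eq[of A] by (auto simp: floor_supp_def P_def)
  have nadj: "Suc m \<notin> P" if "m \<in> P" for m
    using odd_tops_not_adjacent that by (simp add: P_def)
  \<comment> \<open>The two kinds of change have disjoint values under \<open>\<phi>\<close>: one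
    kind lands in \<open>P\<close>, the other just below an element of \<open>P\<close>, and
    \<open>P\<close> has no adjacent elements.\<close>
  have plus: "\<phi> (i, j) \<in> P" if "(i, j) \<in> changes t" "t i = 1" for i j
    using that A by (auto simp: \<phi>_def)
  have minus: "Suc (\<phi> (i, j)) \<in> P" if "(i, j) \<in> changes t" "t i \<noteq> 1" for i j
    using that A[of j] by (auto simp: \<phi>_def changes_iff)
  show "\<phi> ` changes t \<subseteq> floor_supp A"
    using plus minus assms(1) floor_supp_eq[of A] by (fastforce simp: P_def)
  \<comment> \<open>Within one kind, a collision could only come from two neighbouring positive
    ends; the neighbour on the side of the change is zero or negative.\<close>
  have no_next: "t (Suc i) \<noteq> 1" if "(i, j) \<in> changes t" "t i = 1" for i j
    using that by (cases "Suc i = j") (auto simp: changes_iff)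
  have no_prev: "t (j - 1) \<noteq> 1" if "(i, j) \<in> changes t" "t i \<noteq> 1" for i j
    using that by (cases "i = j - 1") (auto simp: changes_iff)
  have right_unique: "j = j'" if "(i, j) \<in> changes t" "(i, j') \<in> changes t" for i j j'
    using that by (cases j j' rule: linorder_cases) (auto simp: changes_iff)
  have left_unique: "i = i'" if "(i, j) \<in> changes t" "(i', j) \<in> changes t" for i i' j
    using that by (cases i i' rule: linorder_cases) (auto simp: changes_iff)
  have "(i, j) = (i', j')"
    if c: "(i, j) \<in> changes t" "(i', j') \<in> changes t" and eq: "\<phi> (i, j) = \<phi> (i', j')" for i j i' j'
  proof (cases "t i = 1")
    case True
    then have "t i' = 1"
      using plus[OF c(1)] minus[OF c(2)] nadj eq by metis
    have "i = i'"
      using eq True \<open>t i' = 1\<close> no_next[OF c(1)] no_next[OF c(2)]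
      by (auto simp: \<phi>_def split: if_splits)
    then show ?thesis using c right_unique by blast
  next
    case False
    then have "t i' \<noteq> 1"
      using plus[OF c(2)] minus[OF c(1)] nadj eq by metis
    have "t j = 1" "t j' = 1" "j > 0" "j' > 0"
      using c False \<open>t i' \<noteq> 1\<close> by (auto simp: changes_iff)
    then have "j = j'"
      using eq False \<open>t i' \<noteq> 1\<close> no_prev[OF c(1)] no_prev[OF c(2)]
      by (auto simp: \<phi>_def split: if_splits)
    then show ?thesis using c left_unique by blast
  qed
  then show "inj_on \<phi> (changes t)"
    by (auto simp: inj_on_def)
qed (rule finite_floor_supp[OF assms(1)])

lemma SC_le_card_floor_supp_ssupp:
  assumes "finite (ssupp s)" "\<And>i. t i \<in> {-1, 0, s i}"
  shows "SC t \<le> card (floor_supp (ssupp s))"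
proof (rule SC_le_card_floor_supp[OF assms(1)])
  fix i assume "t i = 1"
  then show "i \<in> ssupp s" using assms(2)[of i] by (simp add: ssupp_def)
qed

text \<open>There are infinitely many candidates \<open>t\<close>, but their values are bounded;
  this makes the \<open>Max\<close> in \<open>dfrak\<close> meaningful.\<close>

lemma finite_dfrak_candidates:
  assumes "finite (ssupp s)"
  shows "finite {SC t |t. t \<in> sign_seqs \<and> (\<forall>i. t i \<in> {-1, 0, s i})}"
proof (rule finite_subset)
  show "{SC t |t. t \<in> sign_seqs \<and> (\<forall>i. t i \<in> {-1, 0, s i})} \<subseteq> {..card (floor_supp (ssupp s))}"
    using SC_le_card_floor_supp_ssupp[OF assms] by blast
qed simp

lemma SC_le_dfrak:
  assumes "finite (ssupp s)" "t \<in> sign_seqs" "\<And>i. t i \<in> {-1, 0, s i}"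
  shows "SC t \<le> dfrak s"
  unfolding dfrak_def
  using assms(2,3) by (intro Max_ge finite_dfrak_candidates[OF assms(1)] CollectI exI[of _ t]) simp_all

lemma dfrak_eq_card_floor_supp:
  assumes "s \<in> sign_seqs_pos"
  shows "dfrak s = card (floor_supp (ssupp s))"
proof (rule antisym)
  let ?A = "ssupp s"
  have fin: "finite ?A" and vals: "\<And>i. s i \<in> {0, 1}"
    using assms by (auto simp: sign_seqs_pos_def sign_seqs_def ssupp_def)
  let ?T = "{SC t |t. t \<in> sign_seqs \<and> (\<forall>i. t i \<in> {-1, 0, s i})}"
  have "finite ?T" by (rule finite_dfrak_candidates[OF fin])
  moreover have "SC (\<lambda>_. 0) \<in> ?T" by (auto simp: sign_seqs_def)
  ultimately have "Max ?T \<in> ?T" by (intro Max_in) blast+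
  then obtain t where "dfrak s = SC t" "\<forall>i. t i \<in> {-1, 0, s i}"
    unfolding dfrak_def by blast
  then show "dfrak s \<le> card (floor_supp ?A)"
    using SC_le_card_floor_supp_ssupp[OF fin, of t] by metis
  define P where "P = odd_tops ?A"
  have P: "P \<subseteq> ?A" "\<And>m. m \<in> P \<Longrightarrow> Suc m \<notin> P"
    using odd_tops_subset odd_tops_not_adjacent by (auto simp: P_def)
  obtain N where N: "\<And>m. m \<in> ?A \<Longrightarrow> m < N"
    using fin by (auto simp: finite_nat_set_iff_bounded)
  \<comment> \<open>This sequence attains the maximum: with plus exactly on \<open>P\<close>, every
    \<open>m\<close> in the floor starts a change \<open>(m, Suc m)\<close>. The choice of
    \<open>N\<close> beyond the support puts a minus after the last plus as well.\<close>
  define t :: "nat \<Rightarrow> int" where "t = (\<lambda>m. if m \<in> P then 1 else if m \<le> N then -1 else 0)"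
  have "finite {i. t i \<noteq> 0}"
  proof (rule finite_subset)
    show "{i. t i \<noteq> 0} \<subseteq> {..N}"
      using N P(1) by (auto simp: t_def split: if_splits intro: less_imp_le)
  qed simp
  then have t: "t \<in> sign_seqs"
    by (auto simp: sign_seqs_def t_def)
  have "(\<lambda>m. (m, Suc m)) ` floor_supp ?A \<subseteq> changes t"
  proof -
    have "(m, Suc m) \<in> changes t" if "m \<in> P \<or> Suc m \<in> P" for m
    proof -
      have "m < N" using that P(1) N[of m] N[of "Suc m"] by auto
      then show ?thesis using that P(2)[of m] by (auto simp: changes_iff t_def)
    qed
    then show ?thesis using floor_supp_eq[OF fin] by (auto simp: P_def)
  qed
  then have "card (floor_supp ?A) \<le> SC t"
    unfolding SC_eq_card_changes
    using t by (intro card_inj_on_le[where f = "\<lambda>m. (m, Suc m)"])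
      (auto simp: inj_on_def sign_seqs_def intro: finite_changes)
  also have "\<dots> \<le> dfrak s"
  proof (rule SC_le_dfrak[OF fin t])
    fix i show "t i \<in> {-1, 0, s i}"
      using P(1) vals[of i] by (auto simp: t_def ssupp_def)
  qed
  finally show "card (floor_supp ?A) \<le> dfrak s" .
qed

lemma ssupp_Sign: "ssupp (Sign p) = {i. coeff p i \<noteq> 0}"
  by (auto simp: ssupp_def Sign_def split: if_splits)

lemma finite_ssupp_Sign: "finite (ssupp (Sign p))"
  using Sign_in_sign_seqs by (auto simp: sign_seqs_def ssupp_def)

lemma Sign_in_sign_seqs_pos: "nonneg_poly p \<Longrightarrow> Sign p \<in> sign_seqs_pos"
  using Sign_in_sign_seqs[of p] by (auto simp: sign_seqs_pos_def Sign_def nonneg_poly_def not_less)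

lemma ssupp_floor_sign: "ssupp (floor_sign s) = floor_supp (ssupp s)"
  by (auto simp: ssupp_def floor_sign_def)

section \<open>Agreement of two nonnegative polynomials at positive points\<close>

lemma
  fixes f q :: "real poly"
  assumes f: "nonneg_poly f" and q: "nonneg_poly q" and neq: "f \<noteq> q"
    and Z: "finite Z" "\<And>z. z \<in> Z \<Longrightarrow> z > 0 \<and> poly f z = poly q z"
  shows card_agreement_le_dfrak: "card Z \<le> dfrak_poly f"
    and card_agreement_less_dfrak: "lead_coeff (f - q) > 0 \<Longrightarrow> card Z < dfrak_poly f"
proof -
  let ?t = "Sign (f - q)"
  have allowed: "?t i \<in> {-1, 0, Sign f i}" for i
  proof -
    have "coeff f i \<ge> 0" "coeff q i \<ge> 0" using f q by (auto simp: nonneg_poly_def)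
    then show ?thesis by (auto simp: Sign_def)
  qed
  have roots: "card Z \<le> SC ?t"
    using neq Z by (intro card_positive_roots_le_SC) auto
  also have "\<dots> \<le> dfrak_poly f"
    unfolding dfrak_poly_def
    by (intro SC_le_dfrak finite_ssupp_Sign Sign_in_sign_seqs allowed)
  finally show "card Z \<le> dfrak_poly f" .
  assume lc: "lead_coeff (f - q) > 0"
  define e where "e = degree (f - q)"
  \<comment> \<open>A minus is always permitted, and placed just after the positive leading
    coefficient it creates the additional change \<open>(e, Suc e)\<close>.\<close>
  define u where "u = ?t(Suc e := -1)"
  have zero: "?t m = 0" if "m > e" for m
    using that by (simp add: Sign_def e_def coeff_eq_0 del: coeff_diff)
  have "insert (e, Suc e) (changes ?t) \<subseteq> changes u"
  proof -
    have "(e, Suc e) \<in> changes u"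
      using lc by (auto simp: changes_iff u_def Sign_def e_def)
    moreover have "(i, j) \<in> changes u" if c: "(i, j) \<in> changes ?t" for i j
    proof -
      have "?t j \<noteq> 0" "i < j" using c by (auto simp: changes_iff)
      then have "j \<le> e" "i < e" using zero[of j] by (meson not_le, meson not_le order_less_le_trans)
      then show ?thesis using c by (auto simp: changes_iff u_def)
    qed
    ultimately show ?thesis by auto
  qed
  moreover have "(e, Suc e) \<notin> changes ?t"
    using zero[of "Suc e"] by (auto simp: changes_iff)
  moreover have u: "u \<in> sign_seqs"
  proof -
    have "u i = 0" if "i > Suc e" for i using that zero[of i] by (simp add: u_def)
    then have "{i. u i \<noteq> 0} \<subseteq> {..Suc e}" by (auto simp: not_less[symmetric])
    then have "finite {i. u i \<noteq> 0}" by (rule finite_subset) simp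
    then show ?thesis by (auto simp: sign_seqs_def u_def Sign_def)
  qed
  ultimately have "Suc (SC ?t) \<le> SC u"
    unfolding SC_eq_card_changes
    using card_mono[of "changes u" "insert (e, Suc e) (changes ?t)"] finite_changes_Sign[of "f - q"]
    by (auto simp: sign_seqs_def finite_changes)
  also have "SC u \<le> dfrak_poly f"
    unfolding dfrak_poly_def
    by (intro SC_le_dfrak finite_ssupp_Sign u) (use allowed in \<open>auto simp: u_def\<close>)
  finally show "card Z < dfrak_poly f" using roots by simp
qed

text \<open>\<open>dseq\<close> counts from the top starting at 1, the sorted list from the bottom
  starting at 0; the two indices add up to \<open>card B\<close>.\<close>

lemma
  assumes "finite B" "c < card B"
  shows sorted_list_of_set_nth_in: "sorted_list_of_set B ! c \<in> B"
    and dseq_eq_nth: "dseq B (card B - c) = sorted_list_of_set B ! c"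
  using assms nth_mem[of c "sorted_list_of_set B"] by (auto simp: dseq_def rev_nth)

lemma sorted_list_of_set_nth_less:
  assumes "c < c'" "c' < card B"
  shows "sorted_list_of_set B ! c < sorted_list_of_set B ! c'"
  using assms strict_sorted_list_of_set[of B] by (simp add: sorted_wrt_nth_less)

lemma bij_betw_sorted_list_of_set_nth:
  assumes "finite B"
  shows "bij_betw ((!) (sorted_list_of_set B)) {..<card B} B"
  using assms bij_betw_nth[of "sorted_list_of_set B"] by simp

text \<open>This is where odd \<open>j\<close> enters: if \<open>x\<close> in the floor is not in
  \<open>odd_tops A\<close>, the elements from \<open>x\<close> upwards split into complete pairs
  \<open>{p - 1, p}\<close>, so \<open>x\<close> has even rank from the top.\<close>

lemma odd_index_in_odd_tops:
  assumes fin: "finite A" and c: "c < card (floor_supp A)" "odd (card (floor_supp A) - c)"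
  shows "sorted_list_of_set (floor_supp A) ! c \<in> odd_tops A"
proof (rule ccontr)
  define B where "B = floor_supp A"
  define P where "P = odd_tops A"
  define x where "x = sorted_list_of_set B ! c"
  assume "sorted_list_of_set (floor_supp A) ! c \<notin> odd_tops A"
  then have "x \<notin> P" by (simp add: x_def P_def B_def)
  have B: "B = P \<union> {m. Suc m \<in> P}" "finite B"
    using fin floor_supp_eq finite_floor_supp by (auto simp: B_def P_def)
  have nadj: "Suc m \<notin> P" if "m \<in> P" for m
    using odd_tops_not_adjacent that by (simp add: P_def)
  have "x \<in> B" using sorted_list_of_set_nth_in[OF B(2)] c by (simp add: x_def B_def)
  define U where "U = {m \<in> P. m > x}"
  have "finite U" using B by (auto simp: U_def)
  have "{m \<in> B. x \<le> m} = U \<union> (\<lambda>m. m - 1) ` U"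
  proof (intro equalityI subsetI)
    fix m assume m: "m \<in> {m \<in> B. x \<le> m}"
    show "m \<in> U \<union> (\<lambda>m. m - 1) ` U"
    proof (cases "m \<in> P")
      case True
      then show ?thesis using m \<open>x \<notin> P\<close> by (auto simp: U_def nat_less_le)
    next
      case False
      then have "Suc m \<in> U" using m B(1) by (auto simp: U_def)
      then show ?thesis by force
    qed
  qed (auto simp: U_def B(1))
  moreover have "U \<inter> (\<lambda>m. m - 1) ` U = {}"
    using nadj by (force simp: U_def)
  moreover have "inj_on (\<lambda>m. m - 1) U"
    by (auto simp: inj_on_def U_def)
  ultimately have "card {m \<in> B. x \<le> m} = 2 * card U"
    using \<open>finite U\<close> by (simp add: card_Un_disjoint card_image)
  moreover have "card {m \<in> B. x \<le> m} = card B - c"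
  proof -
    let ?g = "(!) (sorted_list_of_set B)"
    have bij: "bij_betw ?g {..<card B} B" by (rule bij_betw_sorted_list_of_set_nth[OF B(2)])
    have le: "x \<le> ?g i \<longleftrightarrow> c \<le> i" if "i < card B" for i
      using that sorted_list_of_set_nth_less[of i c B] sorted_list_of_set_nth_less[of c i B] c
      by (cases i c rule: linorder_cases) (auto simp: x_def B_def)
    have "?g ` {c..<card B} = {m \<in> B. x \<le> m}"
      using bij le unfolding bij_betw_def by force
    moreover have "inj_on ?g {c..<card B}"
      using bij by (auto simp: bij_betw_def intro: inj_on_subset)
    ultimately show ?thesis by (metis card_image card_atLeastLessThan)
  qed
  ultimately show False using c(2) unfolding B_def by presburger
qed

section \<open>Generalized Vandermonde determinants\<close>

text \<open>A change is determined by its left end, which is an exponent of \<open>g\<close> other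
  than the degree.\<close>

lemma SC_Sign_less_card:
  fixes g :: "real poly"
  assumes "g \<noteq> 0" "finite B" "{i. coeff g i \<noteq> 0} \<subseteq> B"
  shows "SC (Sign g) < card B"
proof -
  have nz: "coeff g i \<noteq> 0 \<and> coeff g j \<noteq> 0 \<and> i < j" if "(i, j) \<in> changes (Sign g)" for i j
    using that by (auto simp: changes_iff Sign_def split: if_splits)
  have "SC (Sign g) \<le> card (B - {degree g})"
    unfolding SC_eq_card_changes
  proof (rule card_inj_on_le)
    show "inj_on fst (changes (Sign g))"
    proof (rule inj_onI, clarsimp)
      fix i j j' assume "(i, j) \<in> changes (Sign g)" "(i, j') \<in> changes (Sign g)"
      then show "j = j'"
        by (cases j j' rule: linorder_cases) (auto simp: changes_iff)
    qed
    show "fst ` changes (Sign g) \<subseteq> B - {degree g}"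
    proof clarsimp
      fix i j assume "(i, j) \<in> changes (Sign g)"
      then have "coeff g i \<noteq> 0" "i < j" "j \<le> degree g" using nz le_degree by blast+
      then show "i \<in> B \<and> i \<noteq> degree g" using assms(3) by auto
    qed
  qed (use assms in simp)
  also have "\<dots> < card B"
    using assms by (intro card_Diff1_less) auto
  finally show ?thesis .
qed

lemma card_positive_roots_less_card_support:
  fixes g :: "real poly"
  assumes "g \<noteq> 0" "finite B" "{i. coeff g i \<noteq> 0} \<subseteq> B"
    and "finite Z" "\<And>z. z \<in> Z \<Longrightarrow> z > 0 \<and> poly g z = 0"
  shows "card Z < card B"
  using card_positive_roots_le_SC[OF assms(1,4,5)] SC_Sign_less_card[OF assms(1-3)] by simp

lemma poly_root_ge:
  fixes p :: "real poly"
  assumes "lead_coeff p > 0" "poly p x \<le> 0"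
  shows "\<exists>z\<ge>x. poly p z = 0"
proof (cases "poly p x = 0")
  case False
  obtain N where N: "\<forall>y\<ge>N. poly p y \<ge> lead_coeff p"
    using poly_pinfty_gt_lc[OF assms(1)] by blast
  define y where "y = max N (x + 1)"
  have "poly p y > 0" "x < y" using N assms(1) by (auto simp: y_def intro: less_le_trans)
  then show ?thesis
    using poly_IVT_pos[of x y p] False assms(2) by (meson less_imp_le order_le_imp_less_or_eq)
qed auto

definition gen_vandermonde :: "nat \<Rightarrow> (nat \<Rightarrow> real) \<Rightarrow> (nat \<Rightarrow> nat) \<Rightarrow> real mat" where
  "gen_vandermonde m x e = mat m m (\<lambda>(r, c). x r ^ e c)"

lemma gen_vandermonde_carrier [simp]: "gen_vandermonde m x e \<in> carrier_mat m m"
  by (simp add: gen_vandermonde_def)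

text \<open>As a function of the last node, the determinant is a polynomial \<open>q\<close> with at
  most \<open>m + 1\<close> terms, whose leading coefficient is the smaller determinant. It already
  vanishes at the \<open>m\<close> earlier nodes, so by Descartes it has no further positive root
  and stays positive from \<open>x m\<close> on.\<close>

theorem det_gen_vandermonde_pos:
  assumes "\<And>r. r < m \<Longrightarrow> x r > 0" "strict_mono_on {..<m} x" "strict_mono_on {..<m} e"
  shows "det (gen_vandermonde m x e) > 0"
  using assms
proof (induction m)
  case 0
  then show ?case by simp
next
  case (Suc m)
  have IH: "det (gen_vandermonde m x e) > 0"
    using Suc.prems by (intro Suc.IH) (auto simp: strict_mono_on_def)
  define G where "G = (\<lambda>y. gen_vandermonde (Suc m) (x(m := y)) e)"
  have G: "G y \<in> carrier_mat (Suc m) (Suc m)" for y by (simp add: G_def)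
  \<comment> \<open>Cofactors along the last row do not see the last node, so its value 0 here is
    arbitrary.\<close>
  define C where "C = (\<lambda>c. cofactor (G 0) m c)"
  have cof: "cofactor (G y) m c = C c" if "c < Suc m" for c y
    using that unfolding C_def cofactor_def G_def gen_vandermonde_def mat_delete_def
    by (intro arg_cong[of _ _ "\<lambda>t. _ * det t"] eq_matI) auto
  have Cm: "C m = det (gen_vandermonde m x e)"
    unfolding C_def cofactor_def G_def gen_vandermonde_def mat_delete_def
    by (subst arg_cong[of _ "mat m m (\<lambda>(r, c). x r ^ e c)" det]) (auto intro!: eq_matI)
  define q where "q = (\<Sum>c<Suc m. monom (C c) (e c))"
  have poly_q: "poly q y = det (G y)" for y
  proof -
    have "det (G y) = (\<Sum>c<Suc m. G y $$ (m, c) * cofactor (G y) m c)"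
      using laplace_expansion_row[OF G, of m y] by simp
    also have "\<dots> = (\<Sum>c<Suc m. C c * y ^ e c)"
      by (intro sum.cong refl) (simp add: cof, simp add: G_def gen_vandermonde_def)
    finally show ?thesis by (simp add: q_def poly_sum poly_monom)
  qed
  have e_less: "e c < e m" if "c < m" for c
    using Suc.prems(3) that by (auto simp: strict_mono_on_def)
  have coeff_q: "coeff q i = (\<Sum>c<Suc m. if e c = i then C c else 0)" for i
    by (simp add: q_def coeff_sum)
  have supp: "{i. coeff q i \<noteq> 0} \<subseteq> e ` {..<Suc m}"
  proof (rule subsetI, rule ccontr)
    fix i assume i: "i \<in> {i. coeff q i \<noteq> 0}" "i \<notin> e ` {..<Suc m}"
    have "coeff q i = 0"
      unfolding coeff_q by (rule sum.neutral) (use i(2) in auto)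
    then show False using i(1) by simp
  qed
  have coeff_top: "coeff q (e m) = C m"
  proof -
    have "(\<Sum>c<m. if e c = e m then C c else 0) = 0"
      by (rule sum.neutral) (use e_less in force)
    then show ?thesis by (simp add: coeff_q)
  qed
  have "degree q \<le> e m"
  proof (rule degree_le, intro allI impI)
    fix i assume "e m < i"
    then have "i \<notin> e ` {..<Suc m}" using e_less by (auto simp: less_Suc_eq) (meson less_asym)
    then show "coeff q i = 0" using supp by auto
  qed
  moreover have "e m \<le> degree q" using coeff_top Cm IH by (intro le_degree) simp
  ultimately have lc: "lead_coeff q > 0" using coeff_top Cm IH by simp
  have roots: "poly q (x r) = 0" if "r < m" for r
    unfolding poly_q
    by (rule det_identical_rows[OF G, of m r]) (use that in \<open>auto simp: G_def gen_vandermonde_def\<close>)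
  have "poly q (x m) > 0"
  proof (rule ccontr)
    assume "\<not> poly q (x m) > 0"
    then obtain z where z: "z \<ge> x m" "poly q z = 0" using poly_root_ge[OF lc] by force
    have x_less: "x r < x m" if "r < m" for r
      using Suc.prems(2) that by (auto simp: strict_mono_on_def)
    have "card (insert z (x ` {..<m})) < card (e ` {..<Suc m})"
    proof (rule card_positive_roots_less_card_support[OF _ _ supp])
      show "q \<noteq> 0" using lc by auto
      show "y > 0 \<and> poly q y = 0" if "y \<in> insert z (x ` {..<m})" for y
        using that z roots Suc.prems(1) by (auto intro: less_le_trans)
    qed auto
    moreover have "card (e ` {..<Suc m}) \<le> Suc m"
      using card_image_le[of "{..<Suc m}" e] by simp
    moreover have "card (insert z (x ` {..<m})) = Suc m"
    proof -
      have "inj_on x {..<m}"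
        using Suc.prems(2) by (intro strict_mono_on_imp_inj_on) (auto simp: strict_mono_on_def)
      moreover have "z \<notin> x ` {..<m}" using z x_less by fastforce
      ultimately show ?thesis by (simp add: card_image)
    qed
    ultimately show False by simp
  qed
  then show ?case by (simp add: poly_q G_def)
qed

text \<open>Cramer's rule for a right-hand side that is interpolated by the coefficients \<open>q\<close> except
  for an error \<open>\<delta>\<close> at the last node.\<close>

lemma det_replace_column_gen_vandermonde:
  assumes k: "k < Suc m"
    and y: "\<And>r. r < Suc m \<Longrightarrow> y r = (\<Sum>c<Suc m. q c * x r ^ e c) + (if r = m then \<delta> else 0)"
  shows "det (mat (Suc m) (Suc m) (\<lambda>(r, c). if c = k then y r else x r ^ e c)) =
    q k * det (gen_vandermonde (Suc m) x e)
      + \<delta> * (-1) ^ (m + k) * det (gen_vandermonde m x (\<lambda>c. if c < k then e c else e (Suc c)))"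
proof -
  let ?n = "Suc m"
  define G where "G = gen_vandermonde ?n x e"
  define R where "R = (\<lambda>z. mat ?n ?n (\<lambda>(r, c). if c = k then z r else x r ^ e c))"
  have R: "R z \<in> carrier_mat ?n ?n" for z by (simp add: R_def)
  define C where "C = (\<lambda>r. cofactor (R y) r k)"
  have cof: "cofactor (R z) r k = C r" if "r < ?n" for r z
    using that k unfolding C_def cofactor_def R_def mat_delete_def
    by (intro arg_cong[of _ _ "\<lambda>t. _ * det t"] eq_matI) auto
  have expand: "det (R z) = (\<Sum>r<?n. z r * C r)" for z
  proof -
    have "det (R z) = (\<Sum>r<?n. R z $$ (r, k) * cofactor (R z) r k)"
      using laplace_expansion_column[OF R k] .
    also have "\<dots> = (\<Sum>r<?n. z r * C r)"
      by (intro sum.cong refl) (simp add: cof, simp add: R_def k)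
    finally show ?thesis .
  qed
  let ?u = "\<lambda>r. \<Sum>c<?n. q c * x r ^ e c"
  \<comment> \<open>Linearity in column \<open>k\<close> separates the exactly interpolated part,
    handled by Cramer's rule, from the error, which meets a single cofactor.\<close>
  have "det (R y) = (\<Sum>r<?n. ?u r * C r + (if r = m then \<delta> * C r else 0))"
    unfolding expand by (intro sum.cong refl) (simp add: y algebra_simps)
  also have "\<dots> = det (R ?u) + \<delta> * C m"
    unfolding expand by (simp only: sum.distrib) simp
  also have "R ?u = replace_col G (G *\<^sub>v vec ?n q) k"
    by (rule eq_matI)
      (auto simp: R_def G_def gen_vandermonde_def replace_col_def scalar_prod_def lessThan_atLeast0 mult.commute
            simp del: sum.op_ivl_Suc)
  also have "det \<dots> = q k * det G"
    using cramer_lemma_mat[of G ?n "vec ?n q" k] k by (simp add: G_def)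
  also have "C m = (-1) ^ (m + k) * det (gen_vandermonde m x (\<lambda>c. if c < k then e c else e (Suc c)))"
    unfolding C_def cofactor_def
    by (intro arg_cong[of _ _ "\<lambda>t. _ * det t"] eq_matI)
      (auto simp: R_def mat_delete_def gen_vandermonde_def)
  finally show ?thesis by (simp add: R_def G_def mult.assoc)
qed

text \<open>The solution comes from the adjugate; its Cramer formula is kept so that the signs of
  the coefficients can be read off.\<close>

lemma interpolation_exists:
  assumes "det (gen_vandermonde m x e) \<noteq> 0"
  shows "\<exists>v. (\<forall>r<m. (\<Sum>c<m. v c * x r ^ e c) = y r) \<and>
    (\<forall>k<m. v k * det (gen_vandermonde m x e)
        = det (mat m m (\<lambda>(r, c). if c = k then y r else x r ^ e c)))"
proof -
  define G where "G = gen_vandermonde m x e"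
  have G: "G \<in> carrier_mat m m" by (simp add: G_def)
  define w where "w = (1 / det G) \<cdot>\<^sub>v (adj_mat G *\<^sub>v vec m y)"
  have w: "w \<in> carrier_vec m" using adj_mat(1)[OF G] by (simp add: w_def)
  have "G *\<^sub>v w = (1 / det G) \<cdot>\<^sub>v ((G * adj_mat G) *\<^sub>v vec m y)"
    using G adj_mat(1)[OF G] unfolding w_def
    by (simp add: mult_mat_vec[of _ m m] assoc_mult_mat_vec[of _ m m _ m])
  also have "\<dots> = vec m y"
    using assms unfolding adj_mat(2)[OF G] by (auto simp: G_def)
  finally have Gw: "G *\<^sub>v w = vec m y" .
  have "(\<Sum>c<m. w $ c * x r ^ e c) = y r" if "r < m" for r
    using arg_cong[OF Gw, of "\<lambda>v. v $ r"] that w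
    by (simp add: G_def gen_vandermonde_def scalar_prod_def lessThan_atLeast0 mult.commute)
  moreover have "w $ k * det G = det (mat m m (\<lambda>(r, c). if c = k then y r else x r ^ e c))"
    if "k < m" for k
  proof -
    have "w $ k * det G = det (replace_col G (vec m y) k)"
      using cramer_lemma_mat[OF G w that] Gw by simp
    also have "replace_col G (vec m y) k = mat m m (\<lambda>(r, c). if c = k then y r else x r ^ e c)"
      by (rule eq_matI) (auto simp: replace_col_def G_def gen_vandermonde_def)
    finally show ?thesis .
  qed
  ultimately show ?thesis unfolding G_def by (intro exI[of _ "\<lambda>c. w $ c"]) blast
qed

section \<open>The degree bound\<close>

lemma Dji_eq_det_nth:
  assumes "finite B" "card B = n" "j \<in> {1..n}"
  shows "Dji n a b (dseq B) j i = det (mat n n (\<lambda>(r, c).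
    if c = n - j then b (if Suc r < i then Suc r else Suc (Suc r))
    else a (if Suc r < i then Suc r else Suc (Suc r)) ^ (sorted_list_of_set B ! c)))"
  unfolding Dji_def Let_def
  using assms dseq_eq_nth[OF assms(1)]
  by (intro arg_cong[of _ _ det] eq_matI) auto

lemma poly_eq_sum_sorted_support:
  fixes p :: "real poly"
  assumes "finite B" "{i. coeff p i \<noteq> 0} \<subseteq> B"
  shows "poly p x = (\<Sum>c<card B. coeff p (sorted_list_of_set B ! c) * x ^ (sorted_list_of_set B ! c))"
proof -
  have "poly p x = (\<Sum>i | coeff p i \<noteq> 0. coeff p i * x ^ i)"
    unfolding poly_altdef by (rule sum.mono_neutral_right) (auto simp: le_degree)
  also have "\<dots> = (\<Sum>i\<in>B. coeff p i * x ^ i)"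
    using assms by (intro sum.mono_neutral_left) auto
  also have "\<dots> = (\<Sum>c<card B. coeff p (sorted_list_of_set B ! c) * x ^ (sorted_list_of_set B ! c))"
    using sum.reindex_bij_betw[OF bij_betw_sorted_list_of_set_nth[OF assms(1)], symmetric] .
  finally show ?thesis .
qed

theorem mainTheorem7:
  fixes n :: nat and a b :: "nat \<Rightarrow> real" and f f0 :: "real poly"
  assumes n1: "n \<ge> 1"
    and apos: "a 1 > 0"
    and amono: "\<forall>i\<in>{1..n}. a i < a (Suc i)"
    and bnonneg: "\<forall>i\<in>{1..n+1}. b i \<ge> 0"
    and fmin: "is_minpoly {(a i, b i) | i. i \<in> {1..n+1}} f"
    and f0min: "is_minpoly {(a i, b i) | i. i \<in> {1..n}} f0"
    and df0: "dfrak_poly f0 = n"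
    and neq: "f0 \<noteq> f"
  shows "card (ssupp (floor_sign (Sign f0))) = n
    \<and> (let d = dseq (ssupp (floor_sign (Sign f0))); D = Dji n a b d in
        (\<forall>j\<in>{1..n}. odd j \<longrightarrow> (\<forall>i\<in>{1..n+1}. D j i > 0))
      \<and> degree f \<le> (LEAST k::nat. d 1 < k \<and>
           (\<forall>j\<in>{1..n}. odd j \<longrightarrow> (\<forall>i\<in>{1..n}.
              ln (real n * D j i / D j (n+1)) / ln (a (n+1) / a i) \<le> real k))))"
proof -
  have a_less: "a i < a j" if "1 \<le> i" "i < j" "j \<le> n + 1" for i j
    using that(2,3)
  proof (induction j)
    case (Suc j)
    then have "a j < a (Suc j)" using amono that(1) by auto
    then show ?case using Suc by (cases "i = j") auto
  qed simp
  have a_pos: "a i > 0" if "1 \<le> i" "i \<le> n + 1" for i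
    using a_less[of 1 i] that apos by (cases "i = 1") auto
  have f: "nonneg_poly f" "\<And>i. 1 \<le> i \<Longrightarrow> i \<le> n + 1 \<Longrightarrow> poly f (a i) = b i"
    using fmin by (auto simp: is_minpoly_def)
  have f0: "nonneg_poly f0" "\<And>i. 1 \<le> i \<Longrightarrow> i \<le> n \<Longrightarrow> poly f0 (a i) = b i"
    using f0min by (auto simp: is_minpoly_def)
  have "dfrak_poly f \<le> card ((\<lambda>i. (a i, b i)) ` {1..n+1})"
    using fmin unfolding is_minpoly_def setcompr_eq_image Collect_mem_eq by blast
  also have "\<dots> \<le> n + 1" using card_image_le[of "{1..n+1}"] by simp
  finally have df: "dfrak_poly f \<le> n + 1" .
  have inj: "inj_on a {1..n+1}"
    by (intro strict_mono_on_imp_inj_on) (auto simp: strict_mono_on_def intro: a_less)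
  then have card_a: "card (a ` {1..n}) = n" "card (a ` {1..n+1}) = n + 1"
    by (auto simp: card_image inj_on_subset)

  define \<delta> where "\<delta> = b (n + 1) - poly f0 (a (n + 1))"
  have "\<delta> > 0"
  proof (rule ccontr)
    assume "\<not> \<delta> > 0"
    then have "poly (f - f0) (a (n + 1)) \<le> 0" using f(2)[of "n + 1"] by (simp add: \<delta>_def)
    have agree: "z > 0 \<and> poly f0 z = poly f z" if "z \<in> a ` {1..n}" for z
      using that f(2) f0(2) a_pos by auto
    \<comment> \<open>The strict form of the agreement bound for \<open>f0\<close> excludes this
      sign. Hence \<open>f\<close> eventually exceeds \<open>f0\<close>, and the graphs meet at or
      beyond the last node: an agreement too many for \<open>dfrak_poly f0 = n\<close>.\<close>
    have "\<not> lead_coeff (f0 - f) > 0"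
    proof
      assume lc: "lead_coeff (f0 - f) > 0"
      have "card (a ` {1..n}) < dfrak_poly f0"
        by (rule card_agreement_less_dfrak[OF f0(1) f(1) neq _ agree lc]) simp_all
      then show False using card_a df0 by simp
    qed
    moreover have "lead_coeff (f - f0) = - lead_coeff (f0 - f)"
      by (metis lead_coeff_minus minus_diff_eq)
    moreover have "lead_coeff (f - f0) \<noteq> 0" using neq by (simp add: leading_coeff_0_iff del: coeff_diff)
    ultimately have "lead_coeff (f - f0) > 0" by linarith
    then obtain z where z: "z \<ge> a (n + 1)" "poly (f - f0) z = 0"
      using poly_root_ge \<open>poly (f - f0) (a (n + 1)) \<le> 0\<close> by blast
    have "a i < z" if "i \<in> {1..n}" for i
      using that z(1) a_less[of i "n + 1"] by auto
    then have "z \<notin> a ` {1..n}" by blast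
    then have "card (insert z (a ` {1..n})) = Suc n" using card_a by simp
    moreover have "card (insert z (a ` {1..n})) \<le> dfrak_poly f0"
    proof (rule card_agreement_le_dfrak[OF f0(1) f(1) neq])
      fix y assume "y \<in> insert z (a ` {1..n})"
      moreover have "z > 0" using z(1) a_pos[of "n + 1"] by simp
      ultimately show "y > 0 \<and> poly f0 y = poly f y" using agree z(2) by auto
    qed simp
    ultimately show False using df0 by simp
  qed

  define B where "B = floor_supp (ssupp (Sign f0))"
  have finB: "finite B" by (simp add: B_def finite_floor_supp finite_ssupp_Sign)
  have cardB: "card B = n"
    using df0 dfrak_eq_card_floor_supp[OF Sign_in_sign_seqs_pos[OF f0(1)]]
    by (simp add: B_def dfrak_poly_def)
  \<comment> \<open>Ascending enumeration from index 0, so \<open>e (n - j)\<close> is the exponent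
    d_j.\<close>
  define e where "e = (\<lambda>c. sorted_list_of_set B ! c)"
  have e_less: "e c < e c'" if "c < c'" "c' < n" for c c'
    using that sorted_list_of_set_nth_less[of c c' B] cardB by (simp add: e_def)
  have coeff_pos: "coeff f0 (e (n - j)) > 0" if "j \<in> {1..n}" "odd j" for j
  proof -
    have "e (n - j) \<in> odd_tops (ssupp (Sign f0))"
      using that cardB odd_index_in_odd_tops[OF finite_ssupp_Sign, of "n - j" f0]
      by (simp add: e_def B_def)
    then have "coeff f0 (e (n - j)) \<noteq> 0" using odd_tops_subset ssupp_Sign by blast
    then show ?thesis using f0(1) by (simp add: nonneg_poly_def order_less_le)
  qed
  have coeff_nonneg: "coeff f0 i \<ge> 0" for i using f0(1) by (simp add: nonneg_poly_def)
  have poly_f0: "poly f0 x = (\<Sum>c<n. coeff f0 (e c) * x ^ e c)" for x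
    using poly_eq_sum_sorted_support[OF finB, of f0 x] cardB
    by (auto simp: e_def B_def floor_supp_def ssupp_Sign)

  define D where "D = Dji n a b (dseq B)"
  have D_eq: "D j i = det (mat n n (\<lambda>(r, c).
      if c = n - j then b (if Suc r < i then Suc r else Suc (Suc r))
      else a (if Suc r < i then Suc r else Suc (Suc r)) ^ e c))" if "j \<in> {1..n}" for j i
    unfolding D_def e_def by (rule Dji_eq_det_nth[OF finB cardB that])
  have D_pos: "D j i > 0" if j: "j \<in> {1..n}" "odd j" and i: "i \<in> {1..n+1}" for j i
  proof -
    obtain m where m: "n = Suc m" using n1 by (cases n) auto
    define l where "l = (\<lambda>r. if Suc r < i then Suc r else Suc (Suc r))"
    have l: "1 \<le> l r" "l r \<le> n + 1" if "r < n" for r using that by (auto simp: l_def)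
    have l_less: "l r < l r'" if "r < r'" for r r' using that by (auto simp: l_def)
    \<comment> \<open>Deleting row \<open>n + 1\<close> leaves only nodes where \<open>f0\<close>
      interpolates; deleting any other row keeps the node with error \<open>\<delta>\<close> in last
      position.\<close>
    define \<epsilon> where "\<epsilon> = (if i = n + 1 then 0 else \<delta>)"
    have b_l: "b (l r) = (\<Sum>c<Suc m. coeff f0 (e c) * a (l r) ^ e c) + (if r = m then \<epsilon> else 0)"
      if "r < Suc m" for r
    proof -
      have "b (l r) = poly f0 (a (l r)) + (if r = m then \<epsilon> else 0)"
      proof (cases "i \<le> n \<and> r = m")
        case True
        then show ?thesis using m by (auto simp: l_def \<epsilon>_def \<delta>_def)
      next
        case False
        then have "l r \<le> n" using that i m by (auto simp: l_def)
        then show ?thesis using f0(2)[of "l r"] l(1)[of r] that False m i by (auto simp: \<epsilon>_def)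
      qed
      then show ?thesis unfolding poly_f0 m .
    qed
    have mono: "strict_mono_on {..<Suc m} (\<lambda>r. a (l r))"
      using l l_less m by (auto simp: strict_mono_on_def intro!: a_less)
    have V: "det (gen_vandermonde (Suc m) (\<lambda>r. a (l r)) e) > 0"
      using l m mono e_less by (intro det_gen_vandermonde_pos) (auto simp: strict_mono_on_def a_pos)
    have V': "det (gen_vandermonde m (\<lambda>r. a (l r)) (\<lambda>c. if c < n - j then e c else e (Suc c))) > 0"
      using l m mono e_less by (intro det_gen_vandermonde_pos) (auto simp: strict_mono_on_def a_pos)
    \<comment> \<open>With \<open>n = Suc m\<close> the exponent is 2m + 1 - j, even because
      \<open>j\<close> is odd; the error therefore contributes with a plus sign.\<close>
    have "even (m + (n - j))" using j m by auto
    have "D j i = coeff f0 (e (n - j)) * det (gen_vandermonde (Suc m) (\<lambda>r. a (l r)) e)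
        + \<epsilon> * (-1) ^ (m + (n - j))
          * det (gen_vandermonde m (\<lambda>r. a (l r)) (\<lambda>c. if c < n - j then e c else e (Suc c)))"
      using det_replace_column_gen_vandermonde[OF _ b_l, of "n - j"] j(1) m
      unfolding D_eq[OF j(1)] l_def by simp
    also have "\<dots> > 0"
      using coeff_pos[OF j] V V' \<open>\<delta> > 0\<close> \<open>even (m + (n - j))\<close>
      by (intro add_pos_nonneg mult_pos_pos mult_nonneg_nonneg) (auto simp: \<epsilon>_def)
    finally show ?thesis .
  qed

  define K where "K = (\<lambda>k::nat. dseq B 1 < k \<and> (\<forall>j\<in>{1..n}. odd j \<longrightarrow> (\<forall>i\<in>{1..n}.
      ln (real n * D j i / D j (n+1)) / ln (a (n+1) / a i) \<le> real k)))"
  have deg: "degree f \<le> k" if k: "K k" for k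
  proof (rule ccontr)
    assume "\<not> degree f \<le> k"
    define x where "x = (\<lambda>r. a (Suc r))"
    \<comment> \<open>The exponent \<open>k\<close> is appended as a last column; it exceeds d_1, so
      \<open>e'\<close> stays increasing. Below, \<open>q\<close> pads the coefficients of
      \<open>f0\<close> with 0 at this column.\<close>
    define e' where "e' = (\<lambda>c. if c < n then e c else k)"
    define q where "q = (\<lambda>c. if c < n then coeff f0 (e c) else 0)"
    define V where "V = det (gen_vandermonde (Suc n) x e')"
    have "dseq B 1 = e (n - 1)"
      using dseq_eq_nth[OF finB, of "n - 1"] cardB n1 by (simp add: e_def)
    then have e_top: "e (n - 1) < k" using k by (simp add: K_def)
    have e_k: "e c < k" if "c < n" for c
    proof (cases "c = n - 1")
      case False
      then have "e c < e (n - 1)" using that by (intro e_less) auto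
      then show ?thesis using e_top by simp
    qed (use e_top in simp)
    have mono_e': "strict_mono_on {..<Suc n} e'"
      using e_k e_less by (auto simp: strict_mono_on_def e'_def)
    have mono_x: "strict_mono_on {..<Suc n} x"
      by (auto simp: strict_mono_on_def x_def intro: a_less)
    have x_pos: "x r > 0" if "r < Suc n" for r using that a_pos by (simp add: x_def)
    have "V > 0"
      unfolding V_def using mono_e' mono_x x_pos by (intro det_gen_vandermonde_pos)
    have "\<exists>v. (\<forall>r<Suc n. (\<Sum>c<Suc n. v c * x r ^ e' c) = b (Suc r)) \<and>
      (\<forall>c<Suc n. v c * V
        = det (mat (Suc n) (Suc n) (\<lambda>(r, c'). if c' = c then b (Suc r) else x r ^ e' c')))"
      unfolding V_def
      by (rule interpolation_exists[where y = "\<lambda>r. b (Suc r)"])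
        (use \<open>V > 0\<close> in \<open>simp add: V_def\<close>)
    then obtain v where v_all: "\<forall>r<Suc n. (\<Sum>c<Suc n. v c * x r ^ e' c) = b (Suc r)"
      "\<forall>c<Suc n. v c * V
        = det (mat (Suc n) (Suc n) (\<lambda>(r, c'). if c' = c then b (Suc r) else x r ^ e' c'))"
      by blast
    note v = v_all[rule_format]
    have b_eq: "b (Suc r) = (\<Sum>c<Suc n. q c * x r ^ e' c) + (if r = n then \<delta> else 0)"
      if "r < Suc n" for r
    proof -
      have "(\<Sum>c<Suc n. q c * x r ^ e' c) = poly f0 (x r)"
        by (simp add: poly_f0 q_def e'_def)
      then show ?thesis using f0(2)[of "Suc r"] that by (auto simp: x_def \<delta>_def)
    qed
    have v_nonneg: "v c \<ge> 0" if c: "c < Suc n" for c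
    proof (cases "even (n + c)")
      \<comment> \<open>Column \<open>n - j\<close> with \<open>j\<close> even, including
        \<open>j = 0\<close> for the new exponent \<open>k\<close>: the error term enters with a
        plus sign.\<close>
      case True
      let ?W = "det (gen_vandermonde n x (\<lambda>c'. if c' < c then e' c' else e' (Suc c')))"
      have "?W > 0"
        using mono_e' mono_x x_pos by (intro det_gen_vandermonde_pos) (auto simp: strict_mono_on_def)
      have "v c * V = q c * V + \<delta> * (-1) ^ (n + c) * ?W"
        unfolding v(2)[OF c] unfolding V_def
        by (rule det_replace_column_gen_vandermonde[OF c]) (rule b_eq)
      also have "\<dots> \<ge> 0"
        using True \<open>?W > 0\<close> \<open>V > 0\<close> \<open>\<delta> > 0\<close> coeff_nonneg by (simp add: q_def)
      finally show ?thesis using \<open>V > 0\<close> by (simp add: zero_le_mult_iff)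
    next
      case False
      define j where "j = n - c"
      have c_n: "c < n" using c False by (cases "c = n") auto
      then have j: "j \<in> {1..n}" "odd j" "n - j = c" using False by (auto simp: j_def)
      define R where "R = mat (Suc n) (Suc n) (\<lambda>(r, c'). if c' = c then b (Suc r) else x r ^ e' c')"
      have R: "R \<in> carrier_mat (Suc n) (Suc n)" by (simp add: R_def)
      \<comment> \<open>Removing the column of exponent \<open>k\<close> and one row leaves exactly
        the matrix of a \<open>D j i\<close>, positive since \<open>j\<close> is odd.\<close>
      have cof: "cofactor R r n = (-1) ^ (r + n) * D j (Suc r)" if "r < Suc n" for r
        unfolding cofactor_def D_eq[OF j(1)] j(3) using that c_n
        by (intro arg_cong[of _ _ "\<lambda>t. _ * det t"] eq_matI)
          (auto simp: R_def mat_delete_def x_def e'_def)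
      have "v c * V = (\<Sum>r<Suc n. x r ^ k * ((-1) ^ (r + n) * D j (Suc r)))"
        unfolding v(2)[OF c] R_def[symmetric] laplace_expansion_column[OF R lessI]
        using c_n by (intro sum.cong refl) (simp add: cof, simp add: R_def e'_def)
      also have "\<dots> = (\<Sum>r<n. (-1) ^ (r + n) * (x r ^ k * D j (Suc r))) + x n ^ k * D j (n + 1)"
        by (simp add: algebra_simps)
      also have "\<dots> \<ge> 0"
      proof -
        \<comment> \<open>Exponentiating the logarithmic bound on \<open>k\<close>; the factor
          \<open>n\<close> inside the logarithm makes each of the \<open>n\<close> other terms at
          most one n-th of the last.\<close>
        have small: "x r ^ k * D j (Suc r) \<le> x n ^ k * D j (n + 1) / n" if r: "r < n" for r
        proof -
          have D: "D j (Suc r) > 0" "D j (n + 1) > 0" using r by (auto intro!: D_pos j)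
          have xr: "x r > 0" "x n > x r"
            using r x_pos[of r] mono_x by (auto simp: strict_mono_on_def)
          have "ln (n * D j (Suc r) / D j (n + 1)) / ln (x n / x r) \<le> k"
            using k j r by (auto simp: K_def x_def)
          moreover have "ln (x n / x r) > 0" using xr by simp
          ultimately have "ln (n * D j (Suc r) / D j (n + 1)) \<le> k * ln (x n / x r)"
            by (simp add: field_simps)
          also have "\<dots> = ln ((x n / x r) ^ k)" using xr by (simp add: ln_realpow)
          finally have "n * D j (Suc r) / D j (n + 1) \<le> (x n / x r) ^ k"
            using xr D n1 by (subst (asm) ln_le_cancel_iff) auto
          then show ?thesis
            using xr D n1 by (simp add: power_divide field_simps)
        qed
        have "- (\<Sum>r<n. (-1) ^ (r + n) * (x r ^ k * D j (Suc r))) \<le> (\<Sum>r<n. x n ^ k * D j (n + 1) / n)"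
          unfolding sum_negf[symmetric]
        proof (rule sum_mono)
          fix r assume r: "r \<in> {..<n}"
          have "x r ^ k * D j (Suc r) \<ge> 0"
            using r x_pos[of r] D_pos[OF j(1,2), of "Suc r"] by simp
          then have "- ((-1) ^ (r + n) * (x r ^ k * D j (Suc r))) \<le> x r ^ k * D j (Suc r)"
            by (cases "even (r + n)") auto
          then show "- ((-1) ^ (r + n) * (x r ^ k * D j (Suc r))) \<le> x n ^ k * D j (n + 1) / n"
            using small[of r] r by simp
        qed
        also have "\<dots> = x n ^ k * D j (n + 1)" using n1 by simp
        finally show ?thesis by simp
      qed
      finally show ?thesis using \<open>V > 0\<close> by (simp add: zero_le_mult_iff)
    qed

    define p where "p = (\<Sum>c<Suc n. monom (v c) (e' c))"
    have p: "nonneg_poly p"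
      using v_nonneg by (auto simp: nonneg_poly_def p_def coeff_sum intro!: sum_nonneg add_nonneg_nonneg)
    have "degree p \<le> k"
      unfolding p_def
    proof (rule degree_sum_le)
      fix c assume "c \<in> {..<Suc n}"
      have "e' c \<le> k" using e_k by (simp add: e'_def less_imp_le)
      then show "degree (monom (v c) (e' c)) \<le> k" using degree_monom_le le_trans by blast
    qed simp
    then have less: "degree p < degree f" using \<open>\<not> degree f \<le> k\<close> by simp
    then have "f \<noteq> p" by auto
    have lc: "lead_coeff (f - p) > 0"
    proof -
      have "degree (f - p) = degree f" using less degree_add_eq_left[of "- p" f] by simp
      moreover have "coeff p (degree f) = 0" using less by (rule coeff_eq_0)
      moreover have "lead_coeff f > 0"
      proof -
        have "lead_coeff f \<noteq> 0" using less by auto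
        then show ?thesis using f(1) by (simp add: nonneg_poly_def order_less_le)
      qed
      ultimately show ?thesis by simp
    qed
    have agree: "y > 0 \<and> poly f y = poly p y" if y: "y \<in> a ` {1..n+1}" for y
    proof -
      obtain i where i: "y = a i" "1 \<le> i" "i \<le> n + 1" using y by auto
      then have "poly p y = b i"
        using v(1)[of "i - 1"] by (simp add: p_def poly_sum poly_monom x_def)
      then show ?thesis using i f(2) a_pos by simp
    qed
    have "card (a ` {1..n+1}) < dfrak_poly f"
      by (rule card_agreement_less_dfrak[OF f(1) p \<open>f \<noteq> p\<close> _ agree lc]) simp_all
    then show False using df card_a by simp
  qed
  \<comment> \<open>\<open>LEAST\<close> needs a witness; the bounds are finite in number, so one
    \<open>k\<close> exceeds them all.\<close>
  have "\<exists>k. K k"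
  proof -
    define L where "L = (\<lambda>(j, i). ln (real n * D j i / D j (n+1)) / ln (a (n+1) / a i))"
    define k where "k = Suc (dseq B 1) + nat \<lceil>Max (L ` ({1..n} \<times> {1..n}))\<rceil>"
    have "L (j, i) \<le> real k" if "j \<in> {1..n}" "i \<in> {1..n}" for i j
    proof -
      have "L (j, i) \<le> Max (L ` ({1..n} \<times> {1..n}))" using that by (intro Max_ge) auto
      also have "\<dots> \<le> real k" unfolding k_def by linarith
      finally show ?thesis .
    qed
    then have "K k" by (auto simp: K_def L_def k_def)
    then show ?thesis ..
  qed
  then have "degree f \<le> (LEAST k. K k)" using deg by (metis LeastI_ex)
  then show ?thesis
    using cardB D_pos unfolding K_def D_def ssupp_floor_sign B_def[symmetric] Let_def by blast
qed

end
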